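(* The cubic $7x^3-13x^2+12x-4$ has a unique root $\beta$ satisfying $59/100<\beta<3/5$. Let $$D_8=\begin{pmatrix} 1&1&1&1&0&0&0&0\\ 1&0&0&0&0&0&1&0\\ 0&1&0&0&0&0&1&0\\ 0&0&0&0&1&1&1&0\\ 0&0&1&0&0&0&0&1\\ 0&0&0&1&0&0&0&1\\ 0&0&0&0&1&0&0&1\\ 0&0&0&0&0&1&0&1 \end{pmatrix},$$ let $Z_8=\{1,\dots,8\}^2\setminus\operatorname{supp}D_8$ be the set of zero positions of $D_8$, and let $$A_\beta=\begin{pmatrix} \beta/2&\beta/2&(1-\beta)/2&(1-\beta)/2&0&0&0&0\\ 1-\beta/2&0&0&0&0&0&\beta/2&0\\ 0&1-\beta/2&0&0&0&0&\beta/2&0\\ 0&0&0&0&\beta/2&\beta/2&1-\beta&0\\ 0&0&(1+\beta)/2&0&0&0&0&(1-\beta)/2\\ 0&0&0&(1+\beta)/2&0&0&0&(1-\beta)/2\\ 0&0&0&0&1-\beta/2&0&0&\beta/2\\ 0&0&0&0&0&1-\beta/2&0&\beta/2 \end{pmatrix}.$$ Then: (1) The support $D_8$ is nearly decomposable, the matrix $A_\beta$ has support exactly $D_8$, and the permanent on the entire closed face $\Omega(D_8)=\Omega_8(Z_8)$ has $A_\beta$ as its unique global minimizer. (2) Its permanent is $$\operatorname{per}A_\beta=\frac{13233\beta^2-10268\beta+2536}{67228}\approx 0.01628247758894465.$$ (3) At the prescribed zero $g=(1,5)\in Z_8$, $$\operatorname{per}A_\beta(1\mid5)-\operatorname{per}A_\beta=\frac{286+1599\beta-3232\beta^2}{9604}>\frac{2047}{240100}>0.$$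 (4) The position $g=(1,5)$ is not a tie point for $A_\beta$ (that is, for the support of $D_8$). Consequently the Foregger--Sinkhorn tie-point conjecture is false, i.e. the following assertion does not hold in general: if $A$ is a nearly decomposable matrix that minimizes the permanent on $\Omega_n(Z)$, $(i,j)\in Z$, and $\operatorname{per}A(i\mid j)>\operatorname{per}A$, then $(i,j)$ is a tie point for $A$.
   Context: $\Omega_n$ denotes the polytope of $n\times n$ doubly stochastic matrices (nonnegative real entries, all row and column sums equal to $1$). For a set $Z\subseteq\{1,\dots,n\}^2$ of positions, $\Omega_n(Z)=\{A=(a_{ij})\in\Omega_n : a_{ij}=0 \text{ for every } (i,j)\in Z\}$. For an $n\times n$ zero-one matrix $D$, $\operatorname{supp}D$ is the set of positions of its nonzero entries, $Z(D)=\{1,\dots,n\}^2\setminus\operatorname{supp}D$, and $\Omega(D)=\Omega_n(Z(D))$, the closed face of doubly stochastic matrices whose support is contained in that of $D$. $\operatorname{per}$ denotes the permanent, and $A(i\mid j)$ denotes the submatrix of $A$ obtained by deleting row $i$ and column $j$. An $n\times n$ nonnegative matrix is partly decomposable if it contains an $s\times(n-s)$ zero submatrix for some $1\le s<n$, and is fully indecomposable otherwise. It is nearly decomposable if it is fully indecomposable but replacing any one of its positive entries by zero makes it partly decomposable. These properties depend only on the support (set of positions of positive entries), and are applied to supports (identified with zero-one matrices) in the same way. Let $S$ be a nearly decomposable support (a set of positions) and let $g\notin S$ be a zero position. Then $g$ is a tie point for $S$ if $(S\cup\{g\})\setminus\{e\}$ is partly decomposable for every original support position $e\in S$. A position is a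 tie point for a nearly decomposable matrix $A$ if it is a tie point for the support of $A$. *)

theory Defs
  imports Complex_Main "Jordan_Normal_Form.Determinant"
begin

(* Rows and columns are numbered from 0, as usual for the type mat: the position
   written (i, j) on paper, with 1 \<le> i, j \<le> n, is the pair (i - 1, j - 1) here. *)

definition positions :: "nat \<Rightarrow> (nat \<times> nat) set" where
  "positions n = {..<n} \<times> {..<n}"

(* The sign-free variant of det; like det, it is 0 by convention on non-square matrices. *)
definition permanent :: "'a :: comm_ring_1 mat \<Rightarrow> 'a" where
  "permanent A = (if dim_row A = dim_col A
     then (\<Sum>p \<in> {p. p permutes {0..<dim_row A}}. \<Prod>i = 0..<dim_row A. A $$ (i, p i))
     else 0)"

definition doubly_stochastic_mats :: "nat \<Rightarrow> real mat set" where
  "doubly_stochastic_mats n = {A \<in> carrier_mat n n.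
     (\<forall>i<n. \<forall>j<n. 0 \<le> A $$ (i, j)) \<and>
     (\<forall>i<n. (\<Sum>j<n. A $$ (i, j)) = 1) \<and>
     (\<forall>j<n. (\<Sum>i<n. A $$ (i, j)) = 1)}"

definition ds_face :: "nat \<Rightarrow> (nat \<times> nat) set \<Rightarrow> real mat set" where
  "ds_face n Z = {A \<in> doubly_stochastic_mats n. \<forall>(i, j) \<in> Z. A $$ (i, j) = 0}"

definition supp_mat :: "real mat \<Rightarrow> (nat \<times> nat) set" where
  "supp_mat A = {(i, j). i < dim_row A \<and> j < dim_col A \<and> A $$ (i, j) \<noteq> 0}"

definition zero_one_mat :: "nat \<Rightarrow> (nat \<times> nat) set \<Rightarrow> real mat" where
  "zero_one_mat n S = mat n n (\<lambda>p. if p \<in> S then 1 else 0)"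

(* The next three notions are meant for square nonnegative matrices. The zero submatrix has
   s rows I and n - s columns J, not necessarily contiguous. *)
definition partly_decomposable :: "real mat \<Rightarrow> bool" where
  "partly_decomposable A \<longleftrightarrow> (\<exists>s I J. 1 \<le> s \<and> s < dim_row A \<and>
     I \<subseteq> {..<dim_row A} \<and> card I = s \<and>
     J \<subseteq> {..<dim_col A} \<and> card J = dim_row A - s \<and>
     (\<forall>i\<in>I. \<forall>j\<in>J. A $$ (i, j) = 0))"

definition fully_indecomposable :: "real mat \<Rightarrow> bool" where
  "fully_indecomposable A \<longleftrightarrow> \<not> partly_decomposable A"

definition nearly_decomposable :: "real mat \<Rightarrow> bool" where
  "nearly_decomposable A \<longleftrightarrow> fully_indecomposable A \<and>
     (\<forall>i<dim_row A. \<forall>j<dim_col A. 0 < A $$ (i, j) \<longrightarrow>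
        partly_decomposable (A |\<^sub>m (i, j) \<mapsto> 0))"

(* Meant for a nearly decomposable n \<times> n support S and a position g outside S;
   these side conditions are not part of the definition. *)
definition tie_point_supp :: "nat \<Rightarrow> (nat \<times> nat) set \<Rightarrow> nat \<times> nat \<Rightarrow> bool" where
  "tie_point_supp n S g \<longleftrightarrow>
     (\<forall>e\<in>S. partly_decomposable (zero_one_mat n ((S \<union> {g}) - {e})))"

definition tie_point :: "real mat \<Rightarrow> nat \<times> nat \<Rightarrow> bool" where
  "tie_point A g \<longleftrightarrow> tie_point_supp (dim_row A) (supp_mat A) g"

definition D8 :: "real mat" where
  "D8 = mat_of_rows_list 8
    [[1,1,1,1,0,0,0,0],
     [1,0,0,0,0,0,1,0],
     [0,1,0,0,0,0,1,0],
     [0,0,0,0,1,1,1,0],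
     [0,0,1,0,0,0,0,1],
     [0,0,0,1,0,0,0,1],
     [0,0,0,0,1,0,0,1],
     [0,0,0,0,0,1,0,1]]"

definition Z8 :: "(nat \<times> nat) set" where
  "Z8 = positions 8 - supp_mat D8"

definition A_mat :: "real \<Rightarrow> real mat" where
  "A_mat b = mat_of_rows_list 8
    [[b/2,     b/2,     (1-b)/2, (1-b)/2, 0,       0,       0,   0],
     [1 - b/2, 0,       0,       0,       0,       0,       b/2, 0],
     [0,       1 - b/2, 0,       0,       0,       0,       b/2, 0],
     [0,       0,       0,       0,       b/2,     b/2,     1-b, 0],
     [0,       0,       (1+b)/2, 0,       0,       0,       0,   (1-b)/2],
     [0,       0,       0,       (1+b)/2, 0,       0,       0,   (1-b)/2],
     [0,       0,       0,       0,       1 - b/2, 0,       0,   b/2],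
     [0,       0,       0,       0,       0,       1 - b/2, 0,   b/2]]"

end

theory Submission
  imports Defs "HOL-Combinatorics.Multiset_Permutations"
begin

text \<open>
A matrix of the face is determined by its entries \<open>p, q, r, t\<close> in row 0 and \<open>u, v\<close> in row 3,
because every other row and all columns but 6 and 7 have only two support positions; the remaining
relations are \<open>p + q + r + t = 1\<close> and \<open>u + v = p + q\<close>. The support consists of three copies of one
gadget: a pair of entries \<open>x, y\<close> of one row, in columns that have one further position each, where
these two positions lie in rows whose remaining positions share a column. A permutation either uses
the pair, and then also the shared column, or avoids both; the two cases contribute
\<open>x\<^sup>2(1 - y) + y\<^sup>2(1 - x)\<close> (crossing) and \<open>(1 - x)(1 - y)\<close> (straight). The pairs \<open>r, t\<close> and \<open>u, v\<close>
share column 7, the pairs \<open>p, q\<close> and \<open>r, t\<close> share row 0, and the entry \<open>r + t\<close> at \<open>(3, 6)\<close> is used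
exactly when neither \<open>p, q\<close> nor \<open>u, v\<close> is. So the permanent is
\<open>crossing(p, q) crossing(u, v) straight(r, t) + (1 - s) straight(p, q) straight(u, v) crossing(r, t)\<close>
with \<open>s = p + q = u + v\<close> and \<open>r + t = 1 - s\<close>.

For fixed \<open>s\<close> both contributions of a pair are affine in the product of the pair. The permanent is
therefore a polynomial in \<open>s\<close>, \<open>w = pq\<close>, \<open>w' = uv\<close>, \<open>z = rt\<close> that is affine in each of the three
products, and its minimum over a fiber \<open>0 \<le> w, w' \<le> s\<^sup>2/4\<close>, \<open>0 \<le> z \<le> (1 - s)\<^sup>2/4\<close> is attained at a
corner. At the corner where all three products are maximal (all pairs balanced), it is a
polynomial in \<open>s\<close> whose derivative is the given cubic times a factor that is positive on \<open>[0, 1]\<close>;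
its only minimum on \<open>[0, 1]\<close> is thus at the root \<open>\<beta>\<close>, with value about \<open>0.01628\<close>
(\<open>corner_value_111_min\<close>). At each of the other seven corners the value stays above \<open>1/60\<close> for all \<open>s\<close>
(\<open>corner_value_gt\<close>). Affine interpolation, done once for each of \<open>z\<close>, \<open>w'\<close>, \<open>w\<close>, gives the strict
inequality off the balanced point (\<open>face_polynomial_min\<close>), and a pair whose product is maximal for
its sum consists of equal entries, which gives back \<open>A_mat \<beta>\<close> (\<open>A_mat_unique_minimizer\<close>).

The combinatorial claims use two tests. A set of positions is partly decomposable if some row or
column has a single position, or an explicit zero block exists; this gives near decomposability. It is
fully indecomposable if it contains a permutation and the digraph obtained by contracting that
permutation is strongly connected (\<open>fully_indecomposableI\<close>). In this digraph the positions \<open>(3, 4)\<close>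
and \<open>(0, 4)\<close> are arcs into the same vertex, and each of the two makes it strongly connected. Hence
adding \<open>(0, 4)\<close> makes \<open>(3, 4)\<close> superfluous, so \<open>(0, 4)\<close> is not a tie point, although deleting its row
and column raises the permanent.
\<close>

section \<open>Permanents of sparse matrices\<close>

text \<open>A row is stored as the list of its nonzero entries, each with its column; \<open>C\<close> is the set of columns
that are still free. Scanning a row entry by entry makes the recursion directly executable by
rewriting and keeps the expansion of a sparse matrix small.\<close>

fun sparse_permanent :: "(nat \<times> 'a :: comm_ring_1) list list \<Rightarrow> nat set \<Rightarrow> 'a" where
  "sparse_permanent [] C = 1"
| "sparse_permanent ([] # rs) C = 0"
| "sparse_permanent (((c, x) # r) # rs) C =
     (if c \<in> C then x * sparse_permanent rs (C - {c}) else 0) + sparse_permanent (r # rs) C"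

fun sparse_entry :: "(nat \<times> 'a :: comm_ring_1) list \<Rightarrow> nat \<Rightarrow> 'a" where
  "sparse_entry [] j = 0"
| "sparse_entry ((c, x) # r) j = (if j = c then x else 0) + sparse_entry r j"

lemma sparse_permanent_Cons:
  assumes "finite C"
  shows "sparse_permanent (r # rs) C = (\<Sum>c\<in>C. sparse_entry r c * sparse_permanent rs (C - {c}))"
proof (induction r)
  case Nil
  show ?case by simp
next
  case (Cons a r)
  obtain c x where a: "a = (c, x)" by (cases a)
  have "(\<Sum>j\<in>C. (if j = c then x else 0) * sparse_permanent rs (C - {j}))
      = (if c \<in> C then x * sparse_permanent rs (C - {c}) else 0)"
    using assms by (simp add: if_distrib[of "\<lambda>y. y * _"] sum.delta cong: if_cong)
  then show ?case
    using Cons.IH by (simp add: a distrib_right sum.distrib)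
qed

lemma sum_permutations_of_set_Suc:
  fixes f :: "nat \<Rightarrow> 'a \<Rightarrow> 'b :: comm_ring_1"
  assumes "finite C" "card C = Suc n"
  shows "(\<Sum>xs\<in>permutations_of_set C. \<Prod>i<Suc n. f i (xs ! i))
       = (\<Sum>c\<in>C. f 0 c * (\<Sum>xs\<in>permutations_of_set (C - {c}). \<Prod>i<n. f (Suc i) (xs ! i)))"
proof -
  have "C \<noteq> {}" using assms by auto
  then have "(\<Sum>xs\<in>permutations_of_set C. \<Prod>i<Suc n. f i (xs ! i))
      = (\<Sum>xs\<in>(\<Union>c\<in>C. (#) c ` permutations_of_set (C - {c})). \<Prod>i<Suc n. f i (xs ! i))"
    by (simp add: permutations_of_set_nonempty)
  also have "\<dots> = (\<Sum>c\<in>C. \<Sum>xs\<in>(#) c ` permutations_of_set (C - {c}). \<Prod>i<Suc n. f i (xs ! i))"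
    using assms by (intro sum.UNION_disjoint) auto
  also have "\<dots> = (\<Sum>c\<in>C. \<Sum>xs\<in>permutations_of_set (C - {c}). f 0 c * (\<Prod>i<n. f (Suc i) (xs ! i)))"
    by (rule sum.cong[OF refl], subst sum.reindex)
       (auto simp: prod.lessThan_Suc_shift simp del: prod.lessThan_Suc)
  finally show ?thesis by (simp add: sum_distrib_left)
qed

lemma sparse_permanent_eq_sum:
  assumes "finite C" "card C = length rs"
  shows "sparse_permanent rs C
       = (\<Sum>xs\<in>permutations_of_set C. \<Prod>i<length rs. sparse_entry (rs ! i) (xs ! i))"
  using assms
proof (induction rs arbitrary: C)
  case Nil
  then show ?case by simp
next
  case (Cons r rs)
  have "sparse_permanent (r # rs) C
      = (\<Sum>c\<in>C. sparse_entry r c * sparse_permanent rs (C - {c}))"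
    by (rule sparse_permanent_Cons) (fact Cons.prems)
  also have "\<dots> = (\<Sum>c\<in>C. sparse_entry r c *
      (\<Sum>xs\<in>permutations_of_set (C - {c}). \<Prod>i<length rs. sparse_entry (rs ! i) (xs ! i)))"
    using Cons.prems by (intro sum.cong refl arg_cong2[where f = "(*)"] Cons.IH) auto
  also have "\<dots> = (\<Sum>xs\<in>permutations_of_set C.
      \<Prod>i<length (r # rs). sparse_entry ((r # rs) ! i) (xs ! i))"
    using sum_permutations_of_set_Suc[of C "length rs" "\<lambda>i. sparse_entry ((r # rs) ! i)"] Cons.prems
    by (simp del: prod.lessThan_Suc)
  finally show ?case .
qed

text \<open>The permanent sums over functions, whereas the recursion picks the columns one row at a time; the
orderings of the column set are the common form.\<close>

lemma bij_betw_permutes_lists: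
  "bij_betw (\<lambda>p. map p [0..<n]) {p. p permutes {0..<n}} (permutations_of_set {0..<n})"
proof (rule bij_betw_byWitness[where f' = "\<lambda>xs i. if i < n then xs ! i else i"])
  show "\<forall>p\<in>{p. p permutes {0..<n}}. (\<lambda>i. if i < n then map p [0..<n] ! i else i) = p"
    by (auto simp: fun_eq_iff permutes_not_in)
  have len: "length xs = n" if "xs \<in> permutations_of_set {0..<n}" for xs
    using length_finite_permutations_of_set[OF that] by simp
  then show "\<forall>xs\<in>permutations_of_set {0..<n}. map (\<lambda>i. if i < n then xs ! i else i) [0..<n] = xs"
    by (auto intro!: nth_equalityI)
  show "(\<lambda>p. map p [0..<n]) ` {p. p permutes {0..<n}} \<subseteq> permutations_of_set {0..<n}"
  proof clarify
    fix p assume "p permutes {0..<n}"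
    then show "map p [0..<n] \<in> permutations_of_set {0..<n}"
      by (intro permutations_of_setI) (simp_all add: distinct_map permutes_image permutes_inj_on)
  qed
  show "(\<lambda>xs i. if i < n then xs ! i else i) ` permutations_of_set {0..<n} \<subseteq> {p. p permutes {0..<n}}"
  proof clarify
    fix xs assume xs: "xs \<in> permutations_of_set {0..<n}"
    note d = permutations_of_setD[OF xs] and l = len[OF xs]
    have "bij_betw (\<lambda>i. if i < n then xs ! i else i) {0..<n} {0..<n}
        \<longleftrightarrow> bij_betw ((!) xs) {0..<n} {0..<n}"
      by (rule bij_betw_cong) simp
    also have "\<dots>" using d l by (intro bij_betw_nth) (simp_all add: atLeast0LessThan)
    finally show "(\<lambda>i. if i < n then xs ! i else i) permutes {0..<n}"
      by (rule bij_imp_permutes) simp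
  qed
qed

lemma permanent_sparse:
  assumes A: "A \<in> carrier_mat n n" and len: "length rs = n"
    and entry: "\<And>i j. i < n \<Longrightarrow> j < n \<Longrightarrow> A $$ (i, j) = sparse_entry (rs ! i) j"
  shows "permanent A = sparse_permanent rs {..<n}"
proof -
  have "permanent A = (\<Sum>p | p permutes {0..<n}. \<Prod>i = 0..<n. A $$ (i, p i))"
    using A by (simp add: permanent_def)
  also have "\<dots> = (\<Sum>p | p permutes {0..<n}. \<Prod>i<n. sparse_entry (rs ! i) (map p [0..<n] ! i))"
  proof (rule sum.cong[OF refl])
    fix p assume "p \<in> {p. p permutes {0..<n}}"
    then have "p i < n" if "i < n" for i
      using permutes_in_image[of p "{0..<n}" i] that by simp
    then show "(\<Prod>i = 0..<n. A $$ (i, p i)) = (\<Prod>i<n. sparse_entry (rs ! i) (map p [0..<n] ! i))"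
      unfolding atLeast0LessThan by (intro prod.cong refl) (simp add: entry)
  qed
  also have "\<dots> = (\<Sum>xs\<in>permutations_of_set {0..<n}. \<Prod>i<n. sparse_entry (rs ! i) (xs ! i))"
    by (rule sum.reindex_bij_betw[OF bij_betw_permutes_lists])
  also have "\<dots> = sparse_permanent rs {..<n}"
    using len by (subst sparse_permanent_eq_sum) (simp_all add: atLeast0LessThan)
  finally show ?thesis .
qed

section \<open>Decomposability in terms of supports\<close>

text \<open>The form used below: symmetric in rows and columns, and visibly a property of the support.\<close>

lemma partly_decomposable_iff_supp:
  assumes A: "A \<in> carrier_mat n n"
  shows "partly_decomposable A \<longleftrightarrow>
    (\<exists>I J. I \<subseteq> {..<n} \<and> J \<subseteq> {..<n} \<and> I \<noteq> {} \<and> J \<noteq> {} \<and> card I + card J = n \<and>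
       (I \<times> J) \<inter> supp_mat A = {})"
proof
  assume "partly_decomposable A"
  then obtain I J where IJ: "1 \<le> card I" "card I < n" "I \<subseteq> {..<n}" "J \<subseteq> {..<n}" "card J = n - card I"
      "\<forall>i\<in>I. \<forall>j\<in>J. A $$ (i, j) = 0"
    using A unfolding partly_decomposable_def by auto
  then have "I \<noteq> {}" "J \<noteq> {}" "card I + card J = n" "(I \<times> J) \<inter> supp_mat A = {}"
    by (auto simp: supp_mat_def)
  then show "\<exists>I J. I \<subseteq> {..<n} \<and> J \<subseteq> {..<n} \<and> I \<noteq> {} \<and> J \<noteq> {} \<and> card I + card J = n \<and>
       (I \<times> J) \<inter> supp_mat A = {}"
    using IJ by blast
next
  assume "\<exists>I J. I \<subseteq> {..<n} \<and> J \<subseteq> {..<n} \<and> I \<noteq> {} \<and> J \<noteq> {} \<and> card I + card J = n \<and>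
       (I \<times> J) \<inter> supp_mat A = {}"
  then obtain I J where IJ: "I \<subseteq> {..<n}" "J \<subseteq> {..<n}" "I \<noteq> {}" "J \<noteq> {}" "card I + card J = n"
      "(I \<times> J) \<inter> supp_mat A = {}"
    by blast
  then have "finite I" "finite J" by (auto intro: finite_subset)
  then have "0 < card I" "0 < card J" using IJ by (simp_all add: card_gt_0_iff)
  moreover have "\<forall>i\<in>I. \<forall>j\<in>J. A $$ (i, j) = 0"
    using IJ A by (fastforce simp: supp_mat_def)
  ultimately show "partly_decomposable A"
    using IJ A unfolding partly_decomposable_def
    by - (rule exI[of _ "card I"], rule exI[of _ I], rule exI[of _ J], auto)
qed

lemma partly_decomposableI:
  assumes "A \<in> carrier_mat n n" "I \<subseteq> {..<n}" "J \<subseteq> {..<n}" "I \<noteq> {}" "J \<noteq> {}"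
    and "card I + card J = n" "(I \<times> J) \<inter> supp_mat A = {}"
  shows "partly_decomposable A"
  unfolding partly_decomposable_iff_supp[OF assms(1)] using assms by blast

lemma supp_zero_one_mat: "S \<subseteq> positions n \<Longrightarrow> supp_mat (zero_one_mat n S) = S"
  by (auto simp: supp_mat_def zero_one_mat_def positions_def split: if_splits)

lemma supp_update_zero: "supp_mat (A |\<^sub>m e \<mapsto> 0) = supp_mat A - {e}"
  by (auto simp: supp_mat_def update_mat_def split: if_splits)

lemma nearly_decomposable_cong_supp:
  assumes A: "A \<in> carrier_mat n n" and B: "B \<in> carrier_mat n n"
    and nonneg: "\<And>i j. i < n \<Longrightarrow> j < n \<Longrightarrow> 0 \<le> A $$ (i, j)"
      "\<And>i j. i < n \<Longrightarrow> j < n \<Longrightarrow> 0 \<le> B $$ (i, j)"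
    and supp: "supp_mat A = supp_mat B"
  shows "nearly_decomposable A \<longleftrightarrow> nearly_decomposable B"
proof -
  have pos: "0 < A $$ (i, j) \<longleftrightarrow> (i, j) \<in> supp_mat A" "0 < B $$ (i, j) \<longleftrightarrow> (i, j) \<in> supp_mat B"
    if "i < n" "j < n" for i j
    using nonneg[OF that] that A B by (auto simp: supp_mat_def)
  have "partly_decomposable (A |\<^sub>m e \<mapsto> 0) \<longleftrightarrow> partly_decomposable (B |\<^sub>m e \<mapsto> 0)" for e
  proof -
    have "A |\<^sub>m e \<mapsto> 0 \<in> carrier_mat n n" "B |\<^sub>m e \<mapsto> 0 \<in> carrier_mat n n"
      using A B by (simp_all add: update_mat_def)
    then show ?thesis
      by (simp add: partly_decomposable_iff_supp supp_update_zero supp)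
  qed
  moreover have "partly_decomposable A \<longleftrightarrow> partly_decomposable B"
    using A B by (simp add: partly_decomposable_iff_supp supp)
  ultimately show ?thesis
    using A B pos supp unfolding nearly_decomposable_def fully_indecomposable_def by auto
qed

text \<open>Suppose that the rows \<open>I\<close> and the columns \<open>J\<close> span a zero block with \<open>card I + card J = n\<close>. The columns
that \<open>\<pi>\<close> assigns to \<open>I\<close> avoid \<open>J\<close>, so by counting they are exactly the complement of \<open>J\<close>. Thus a
position in a row of \<open>I\<close> can only lie in a column assigned to \<open>I\<close>: the set \<open>I\<close> is closed under the arcs
\<open>i \<rightarrow> k\<close> that the positions \<open>(i, \<pi> k)\<close> define. The last assumption says that this digraph is strongly
connected, which forces \<open>J\<close> to be empty.\<close>

lemma fully_indecomposableI:
  assumes A: "A \<in> carrier_mat n n"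
    and perm: "bij_betw \<pi> {..<n} {..<n}"
    and diagonal: "\<And>i. i < n \<Longrightarrow> (i, \<pi> i) \<in> supp_mat A"
    and connected: "\<And>I. I \<subseteq> {..<n} \<Longrightarrow> I \<noteq> {} \<Longrightarrow>
      (\<And>i k. i \<in> I \<Longrightarrow> k < n \<Longrightarrow> (i, \<pi> k) \<in> supp_mat A \<Longrightarrow> k \<in> I) \<Longrightarrow> I = {..<n}"
  shows "fully_indecomposable A"
  unfolding fully_indecomposable_def
proof
  assume "partly_decomposable A"
  then obtain I J where I: "I \<subseteq> {..<n}" "I \<noteq> {}" and J: "J \<subseteq> {..<n}" "J \<noteq> {}"
      and card: "card I + card J = n" and zero: "(I \<times> J) \<inter> supp_mat A = {}"
    unfolding partly_decomposable_iff_supp[OF A] by blast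
  have inj: "inj_on \<pi> {..<n}" and img: "\<pi> ` {..<n} = {..<n}"
    using perm by (auto simp: bij_betw_def)
  have fin: "finite I" "finite J" using I J finite_subset by blast+
  have disj: "\<pi> ` I \<inter> J = {}"
    using diagonal zero I by blast
  have "card (\<pi> ` I \<union> J) = n"
    using card disj fin inj I by (simp add: card_Un_disjoint card_image inj_on_subset)
  moreover have "\<pi> ` I \<union> J \<subseteq> {..<n}" using I J img by blast
  ultimately have cover: "\<pi> ` I \<union> J = {..<n}"
    by (intro card_subset_eq) auto
  have "I = {..<n}"
  proof (rule connected)
    fix i k assume ik: "i \<in> I" "k < n" "(i, \<pi> k) \<in> supp_mat A"
    then have "\<pi> k \<notin> J" using zero by blast
    moreover have "\<pi> k \<in> {..<n}" using ik img by blast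
    ultimately have "\<pi> k \<in> \<pi> ` I" using cover by blast
    then show "k \<in> I" using inj ik I by (auto dest: inj_onD)
  qed (use I in auto)
  then have "card J = 0" using card by simp
  then show False using J fin by simp
qed

lemma supp_mat_eqI:
  assumes "A \<in> carrier_mat n n" "S \<subseteq> {..<n} \<times> {..<n}"
    and "\<forall>i<n. \<forall>j<n. A $$ (i, j) \<noteq> 0 \<longleftrightarrow> (i, j) \<in> S"
  shows "supp_mat A = S"
  using assms by (auto simp: supp_mat_def)

lemma partly_decomposable_single_row:
  assumes A: "A \<in> carrier_mat n n" and "2 \<le> n" "i < n" "c < n" and row: "\<And>j. (i, j) \<in> supp_mat A \<Longrightarrow> j = c"
  shows "partly_decomposable A"
proof -
  have "card ({..<n} - {c}) = n - 1" using assms by simp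
  moreover from this have "{..<n} - {c} \<noteq> {}"
    using \<open>2 \<le> n\<close> by (metis card.empty diff_is_0_eq not_less_eq_eq numeral_2_eq_2 One_nat_def)
  ultimately show ?thesis
    using assms by (intro partly_decomposableI[OF A, of "{i}" "{..<n} - {c}"]) auto
qed

lemma partly_decomposable_single_column:
  assumes A: "A \<in> carrier_mat n n" and "2 \<le> n" "j < n" "c < n" and col: "\<And>i. (i, j) \<in> supp_mat A \<Longrightarrow> i = c"
  shows "partly_decomposable A"
proof -
  have "card ({..<n} - {c}) = n - 1" using assms by simp
  moreover from this have "{..<n} - {c} \<noteq> {}"
    using \<open>2 \<le> n\<close> by (metis card.empty diff_is_0_eq not_less_eq_eq numeral_2_eq_2 One_nat_def)
  ultimately show ?thesis
    using assms by (intro partly_decomposableI[OF A, of "{..<n} - {c}" "{j}"]) auto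
qed

section \<open>Decomposability of the support\<close>

lemma lessThan_8: "{..<8} = {0, 1, 2, 3, 4, 5, 6, 7::nat}"
  by auto

lemma all_less_8: "(\<forall>i<8. P i) \<longleftrightarrow> P 0 \<and> P 1 \<and> P 2 \<and> P 3 \<and> P 4 \<and> P 5 \<and> P 6 \<and> P (7::nat)"
proof -
  have "(\<forall>i<8. P i) \<longleftrightarrow> (\<forall>i\<in>{..<8}. P i)" by blast
  then show ?thesis unfolding lessThan_8 by simp
qed

lemma D8_carrier: "D8 \<in> carrier_mat 8 8"
  by (intro carrier_matI) (simp_all add: D8_def mat_of_rows_list_def)

lemma supp_D8: "supp_mat D8 =
   {(0,0), (0,1), (0,2), (0,3), (1,0), (1,6), (2,1), (2,6), (3,4), (3,5), (3,6), (4,2), (4,7),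
    (5,3), (5,7), (6,4), (6,7), (7,5), (7,7)}"
  by (rule supp_mat_eqI[OF D8_carrier])
    (simp_all add: all_less_8 D8_def mat_of_rows_list_def)

lemma supp_D8_positions: "supp_mat D8 \<subseteq> positions 8"
  unfolding supp_D8 positions_def by simp

text \<open>A permutation inside the support that avoids the position \<open>(3, 4)\<close>, so that it serves the original
support as well as the one in which \<open>(3, 4)\<close> is exchanged for \<open>(0, 4)\<close>.\<close>

definition matching :: "nat \<Rightarrow> nat" where
  "matching i = [0, 6, 1, 5, 2, 3, 4, 7] ! i"

lemma matching_bij: "bij_betw matching {..<8} {..<8}"
  unfolding bij_betw_def inj_on_def lessThan_8 matching_def by auto

text \<open>The ten arcs below connect everything except that nothing leads into vertex 6. As column 4 is
matched to row 6, the arcs into vertex 6 come from the positions in column 4: \<open>(3, 4)\<close> gives \<open>3 \<rightarrow> 6\<close>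
and \<open>(0, 4)\<close> gives \<open>0 \<rightarrow> 6\<close>. Either of them completes the strong connection.\<close>

lemma fully_indecomposable_D8_exchange:
  assumes A: "A \<in> carrier_mat 8 8"
    and rest: "supp_mat D8 - {(3, 4)} \<subseteq> supp_mat A"
    and exchange: "(3, 4) \<in> supp_mat A \<or> (0, 4) \<in> supp_mat A"
  shows "fully_indecomposable A"
proof (rule fully_indecomposableI[OF A matching_bij])
  have "\<forall>i<8. (i, matching i) \<in> supp_mat D8 - {(3, 4)}"
    by (simp add: all_less_8 matching_def supp_D8)
  then show "(i, matching i) \<in> supp_mat A" if "i < 8" for i
    using that rest by blast
next
  fix I assume I: "I \<subseteq> {..<8}" "I \<noteq> {}"
    and closed: "\<And>i k. i \<in> I \<Longrightarrow> k < 8 \<Longrightarrow> (i, matching k) \<in> supp_mat A \<Longrightarrow> k \<in> I"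
  have arcs: "(0, matching 2) \<in> supp_mat A" "(0, matching 4) \<in> supp_mat A" "(0, matching 5) \<in> supp_mat A"
    "(1, matching 0) \<in> supp_mat A" "(2, matching 1) \<in> supp_mat A" "(3, matching 1) \<in> supp_mat A"
    "(4, matching 7) \<in> supp_mat A" "(5, matching 7) \<in> supp_mat A" "(6, matching 7) \<in> supp_mat A"
    "(7, matching 3) \<in> supp_mat A"
    by (rule subsetD[OF rest], simp add: matching_def supp_D8)+
  have step: "0 \<in> I \<Longrightarrow> 2 \<in> I" "0 \<in> I \<Longrightarrow> 4 \<in> I" "0 \<in> I \<Longrightarrow> 5 \<in> I" "1 \<in> I \<Longrightarrow> 0 \<in> I" "2 \<in> I \<Longrightarrow> 1 \<in> I"
    "3 \<in> I \<Longrightarrow> 1 \<in> I" "4 \<in> I \<Longrightarrow> 7 \<in> I" "5 \<in> I \<Longrightarrow> 7 \<in> I" "6 \<in> I \<Longrightarrow> 7 \<in> I" "7 \<in> I \<Longrightarrow> 3 \<in> I"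
    by (erule closed, simp, fact arcs)+
  have "matching 6 = 4" by (simp add: matching_def)
  then have step6: "(3 \<in> I \<longrightarrow> 6 \<in> I) \<or> (0 \<in> I \<longrightarrow> 6 \<in> I)"
    using exchange closed[of 3 6] closed[of 0 6] by auto
  obtain i where "i \<in> I" "i \<in> {..<8}" using I by blast
  then have "0 \<in> I \<or> 1 \<in> I \<or> 2 \<in> I \<or> 3 \<in> I \<or> 4 \<in> I \<or> 5 \<in> I \<or> 6 \<in> I \<or> 7 \<in> I"
    unfolding lessThan_8 by blast
  then have "{..<8} \<subseteq> I"
    unfolding lessThan_8 insert_subset using step step6 by blast
  with I show "I = {..<8}" by blast
qed

lemma fully_indecomposable_D8: "fully_indecomposable D8"
  by (rule fully_indecomposable_D8_exchange[OF D8_carrier]) (auto simp: supp_D8)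

lemma not_tie_point_D8: "\<not> tie_point_supp 8 (supp_mat D8) (0, 4)"
proof -
  let ?T = "(supp_mat D8 \<union> {(0, 4)}) - {(3, 4)}"
  have "?T \<subseteq> positions 8" using supp_D8_positions by (auto simp: positions_def)
  then have "supp_mat (zero_one_mat 8 ?T) = ?T" by (rule supp_zero_one_mat)
  then have "fully_indecomposable (zero_one_mat 8 ?T)"
    by (intro fully_indecomposable_D8_exchange) (auto simp: zero_one_mat_def)
  moreover have "(3, 4) \<in> supp_mat D8" by (simp add: supp_D8)
  ultimately show ?thesis
    unfolding tie_point_supp_def fully_indecomposable_def by blast
qed

text \<open>Every position except \<open>(3, 6)\<close> lies in a row or a column with just two positions, and deleting it
leaves only one there. Without \<open>(3, 6)\<close>, the columns 0, 1, 6 are supported in the rows 0, 1, 2.\<close>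

lemma nearly_decomposable_D8: "nearly_decomposable D8"
  unfolding nearly_decomposable_def
proof (intro conjI allI impI)
  show "fully_indecomposable D8" by (rule fully_indecomposable_D8)
next
  fix i j assume ij: "i < dim_row D8" "j < dim_col D8" "0 < D8 $$ (i, j)"
  let ?B = "D8 |\<^sub>m (i, j) \<mapsto> 0"
  have B: "?B \<in> carrier_mat 8 8" using D8_carrier by (simp add: update_mat_def)
  have supp: "supp_mat ?B = supp_mat D8 - {(i, j)}" by (rule supp_update_zero)
  have e: "(i, j) \<in> supp_mat D8" using ij by (simp add: supp_mat_def)
  show "partly_decomposable ?B"
  proof (cases "(i, j) = (3, 6)")
    case True
    have "({3, 4, 5, 6, 7} \<times> {0, 1, 6}) \<inter> supp_mat ?B = {}"
      unfolding supp unfolding True supp_D8 by auto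
    then show ?thesis
      by (intro partly_decomposableI[OF B, of "{3, 4, 5, 6, 7}" "{0, 1, 6}"]) auto
  next
    case False
    have "\<forall>(i, j)\<in>supp_mat D8. (i, j) = (3, 6) \<or>
        (\<exists>c\<in>{..<8}. \<forall>k\<in>{..<8}. (i, k) \<in> supp_mat D8 \<longrightarrow> k = j \<or> k = c) \<or>
        (\<exists>c\<in>{..<8}. \<forall>k\<in>{..<8}. (k, j) \<in> supp_mat D8 \<longrightarrow> k = i \<or> k = c)"
      unfolding supp_D8 lessThan_8 by simp
    then have "(\<exists>c\<in>{..<8}. \<forall>k\<in>{..<8}. (i, k) \<in> supp_mat D8 \<longrightarrow> k = j \<or> k = c) \<or>
        (\<exists>c\<in>{..<8}. \<forall>k\<in>{..<8}. (k, j) \<in> supp_mat D8 \<longrightarrow> k = i \<or> k = c)"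
      using e False by blast
    then show ?thesis
    proof (elim disjE bexE)
      fix c assume "c \<in> {..<8}" "\<forall>k\<in>{..<8}. (i, k) \<in> supp_mat D8 \<longrightarrow> k = j \<or> k = c"
      then show ?thesis using e supp_D8_positions unfolding positions_def
        by (intro partly_decomposable_single_row[OF B, of i c]) (auto simp: supp)
    next
      fix c assume "c \<in> {..<8}" "\<forall>k\<in>{..<8}. (k, j) \<in> supp_mat D8 \<longrightarrow> k = i \<or> k = c"
      then show ?thesis using e supp_D8_positions unfolding positions_def
        by (intro partly_decomposable_single_column[OF B, of j c]) (auto simp: supp)
    qed
  qed
qed

section \<open>The face as a trilinear polynomial\<close>

text \<open>The six free entries of a matrix in the face, with all other entries as the row and column sums force
them.\<close>

definition face_rows :: "real \<Rightarrow> real \<Rightarrow> real \<Rightarrow> real \<Rightarrow> real \<Rightarrow> real \<Rightarrow> (nat \<times> real) list list" where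
  "face_rows p q r t u v =
    [[(0, p), (1, q), (2, r), (3, t)],
     [(0, 1 - p), (6, p)],
     [(1, 1 - q), (6, q)],
     [(4, u), (5, v), (6, r + t)],
     [(2, 1 - r), (7, r)],
     [(3, 1 - t), (7, t)],
     [(4, 1 - u), (7, u)],
     [(5, 1 - v), (7, v)]]"

lemma sparse_permanent_face_rows:
  "sparse_permanent (face_rows p q r t u v) {..<8} =
    (p^2*(1-q)+q^2*(1-p)) * (u^2*(1-v)+v^2*(1-u)) * ((1-r)*(1-t))
   + (r+t) * ((1-p)*(1-q)) * ((1-u)*(1-v)) * (r^2*(1-t)+t^2*(1-r))"
  unfolding face_rows_def lessThan_8
  by (simp add: insert_Diff_if) (simp add: algebra_simps power2_eq_square)

text \<open>The expression \<open>p\<^sup>2(1 - q) + q\<^sup>2(1 - p)\<close> in terms of the sum \<open>s\<close> and the product \<open>w\<close> of the pair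
\<open>p, q\<close>. It collects the ways to use one entry of the pair together with the shared column.\<close>

definition crossing :: "real \<Rightarrow> real \<Rightarrow> real" where
  "crossing s w = s^2 - (2 + s) * w"

text \<open>The expression \<open>(1 - p)(1 - q)\<close> in terms of the sum \<open>s\<close> and the product \<open>w\<close> of the pair \<open>p, q\<close>.\<close>

definition straight :: "real \<Rightarrow> real \<Rightarrow> real" where
  "straight s w = 1 - s + w"

definition face_polynomial :: "real \<Rightarrow> real \<Rightarrow> real \<Rightarrow> real \<Rightarrow> real" where
  "face_polynomial s w w' z =
     crossing s w * crossing s w' * straight (1 - s) z
   + (1 - s) * (straight s w * straight s w' * crossing (1 - s) z)"

lemma crossing_eq: "p^2 * (1 - q) + q^2 * (1 - p) = crossing (p + q) (p * q)"
  by (simp add: crossing_def algebra_simps power2_eq_square)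

lemma straight_eq: "(1 - p) * (1 - q) = straight (p + q) (p * q)"
  by (simp add: straight_def algebra_simps)

text \<open>With the product kept at a fixed fraction \<open>c\<close> of its largest possible value \<open>s\<^sup>2/4\<close>, both gadget
contributions are monotone in the sum \<open>s\<close>. Treating \<open>c\<close> as a parameter covers the unbalanced
(\<open>c = 0\<close>) and the balanced (\<open>c = 1\<close>) pair at once.\<close>

lemma crossing_mono:
  assumes "0 \<le> c" "c \<le> 1" "0 \<le> a" "a \<le> b" "b \<le> 1"
  shows "crossing a (c * (a^2/4)) \<le> crossing b (c * (b^2/4))"
proof -
  have "(a + b)^2 \<le> (a + b) * 2"
    unfolding power2_eq_square using assms by (intro mult_left_mono) auto
  moreover have "a^2 + a*b + b^2 \<le> (a + b)^2"
    using assms by (simp add: power2_eq_square algebra_simps)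
  ultimately have "c * (2 * (a + b) + (a^2 + a*b + b^2)) \<le> 1 * (4 * (a + b))"
    using assms by (intro mult_mono) auto
  then have "0 \<le> (b - a) * (4 * (a + b) - c * (2 * (a + b) + (a^2 + a*b + b^2)))"
    using assms by simp
  also have "\<dots> = 4 * (crossing b (c * (b^2/4)) - crossing a (c * (a^2/4)))"
    by (simp add: crossing_def field_simps power2_eq_square)
  finally show ?thesis by simp
qed

lemma straight_antimono:
  assumes "0 \<le> c" "c \<le> 1" "0 \<le> a" "a \<le> b" "b \<le> 1"
  shows "straight b (c * (b^2/4)) \<le> straight a (c * (a^2/4))"
proof -
  have "c * (a + b) \<le> 1 * 2" using assms by (intro mult_mono) auto
  then have "0 \<le> (b - a) * (4 - c * (a + b))" using assms by simp
  also have "\<dots> = 4 * (straight a (c * (a^2/4)) - straight b (c * (b^2/4)))"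
    by (simp add: straight_def algebra_simps power2_eq_square)
  finally show ?thesis by simp
qed

lemma crossing_nonneg: "0 \<le> c \<Longrightarrow> c \<le> 1 \<Longrightarrow> 0 \<le> a \<Longrightarrow> a \<le> 1 \<Longrightarrow> 0 \<le> crossing a (c * (a^2/4))"
  using crossing_mono[of c 0 a] by (simp add: crossing_def)

lemma straight_nonneg: "0 \<le> c \<Longrightarrow> c \<le> 1 \<Longrightarrow> 0 \<le> a \<Longrightarrow> a \<le> 1 \<Longrightarrow> 0 \<le> straight a (c * (a^2/4))"
  by (simp add: straight_def)

text \<open>At \<open>c, c', d \<in> {0, 1}\<close> these are the values at the eight corners of the fiber over \<open>s\<close>.\<close>

definition corner_value :: "real \<Rightarrow> real \<Rightarrow> real \<Rightarrow> real \<Rightarrow> real" where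
  "corner_value c c' d s = face_polynomial s (c * (s^2/4)) (c' * (s^2/4)) (d * ((1 - s)^2/4))"

text \<open>By monotonicity the first summand of the permanent grows with \<open>s\<close> and the second one falls. On an
interval \<open>[a, b]\<close> the first is at least its value at \<open>a\<close> and the second at least its value at \<open>b\<close>.\<close>

lemma corner_value_lower:
  assumes c: "0 \<le> c" "c \<le> 1" "0 \<le> c'" "c' \<le> 1" "0 \<le> d" "d \<le> 1"
    and s: "0 \<le> a" "a \<le> s" "s \<le> b" "b \<le> 1"
  shows "crossing a (c * (a^2/4)) * crossing a (c' * (a^2/4)) * straight (1 - a) (d * ((1 - a)^2/4))
     + (1 - b) * (straight b (c * (b^2/4)) * straight b (c' * (b^2/4)) * crossing (1 - b) (d * ((1 - b)^2/4)))
    \<le> corner_value c c' d s"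
  unfolding corner_value_def face_polynomial_def using c s
  by (intro add_mono mult_mono crossing_mono straight_antimono mult_nonneg_nonneg
      crossing_nonneg straight_nonneg) auto

lemma corner_value_swap: "corner_value c c' d s = corner_value c' c d s"
  by (simp add: corner_value_def face_polynomial_def)

text \<open>The seven corners that do not compete. The constant \<open>1/60 \<approx> 0.01667\<close> separates them from the minimum
\<open>0.01628\<close> at the eighth corner. The interval endpoints are chosen such that the step bound of
\<open>corner_value_lower\<close> exceeds it on each piece; the corner \<open>(1, 1, 0)\<close>, with minimum about \<open>0.0219\<close>
near \<open>s = 2/3\<close>, needs the finest subdivision.\<close>

lemma corner_value_gt:
  assumes s: "0 \<le> s" "s \<le> 1"
    and c: "c \<in> {0, 1}" "c' \<in> {0, 1}" "d \<in> {0, 1}" "(c, c', d) \<noteq> (1, 1, 1)"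
  shows "corner_value c c' d s > 1/60"
proof -
  note low = corner_value_lower[of _ _ _ _ s] and defs = crossing_def straight_def power2_eq_square
  have "1/60 < corner_value 0 0 0 s"
    using low[of 0 0 0 0 "1/2"] low[of 0 0 0 "1/2" 1] s by (cases "s \<le> 1/2") (simp_all add: defs)
  moreover have "1/60 < corner_value 0 0 1 s"
    using low[of 0 0 1 0 "9/20"] low[of 0 0 1 "9/20" 1] s by (cases "s \<le> 9/20") (simp_all add: defs)
  moreover have "1/60 < corner_value 0 1 0 s"
    using low[of 0 1 0 0 "11/20"] low[of 0 1 0 "11/20" 1] s by (cases "s \<le> 11/20") (simp_all add: defs)
  moreover have "1/60 < corner_value 0 1 1 s"
    using low[of 0 1 1 0 "9/20"] low[of 0 1 1 "9/20" "11/20"] low[of 0 1 1 "11/20" 1] s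
    by (cases "s \<le> 9/20"; cases "s \<le> 11/20") (simp_all add: defs)
  moreover have "1/60 < corner_value 1 1 0 s"
    using low[of 1 1 0 0 "59/100"] low[of 1 1 0 "59/100" "16/25"] low[of 1 1 0 "16/25" "7/10"]
      low[of 1 1 0 "7/10" 1] s
    by (cases "s \<le> 59/100"; cases "s \<le> 16/25"; cases "s \<le> 7/10") (simp_all add: defs)
  ultimately show ?thesis
    using c corner_value_swap[of 1 0] by auto
qed

section \<open>The critical cubic\<close>

definition critical_cubic :: "real \<Rightarrow> real" where
  "critical_cubic b = 7*b^3 - 13*b^2 + 12*b - 4"

text \<open>The difference quotient of the cubic is a quadratic polynomial in the two arguments; completing the
squares shows that it is positive.\<close>

lemma critical_cubic_strict_mono: "strict_mono critical_cubic"
proof (rule strict_monoI)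
  fix a b :: real assume "a < b"
  have "0 < 7 * (a + b/2 - 13/14)^2 + 21/4 * (b - 13/21)^2 + 83/21"
    by (intro add_nonneg_pos add_nonneg_nonneg) auto
  also have "\<dots> = 7 * (a^2 + a*b + b^2) - 13 * (a + b) + 12"
    by (simp add: power2_eq_square field_simps)
  finally have "0 < (b - a) * (7 * (a^2 + a*b + b^2) - 13 * (a + b) + 12)"
    using \<open>a < b\<close> by simp
  also have "\<dots> = critical_cubic b - critical_cubic a"
    by (simp add: critical_cubic_def algebra_simps power2_eq_square power3_eq_cube)
  finally show "critical_cubic a < critical_cubic b" by simp
qed

lemma critical_cubic_root_exists: "\<exists>b. 59/100 < b \<and> b < 3/5 \<and> critical_cubic b = 0"
proof -
  have "\<exists>b\<ge>59/100. b \<le> 3/5 \<and> critical_cubic b = 0"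
    by (rule IVT') (auto simp: critical_cubic_def power2_eq_square power3_eq_cube intro!: continuous_intros)
  then obtain b where b: "59/100 \<le> b" "b \<le> 3/5" "critical_cubic b = 0" by blast
  have "critical_cubic (59/100) \<noteq> 0" "critical_cubic (3/5) \<noteq> 0"
    by (simp_all add: critical_cubic_def power2_eq_square power3_eq_cube)
  with b(3) have "b \<noteq> 59/100" "b \<noteq> 3/5" by metis+
  with b show ?thesis by (intro exI[of _ b]) auto
qed

text \<open>The enclosure has width \<open>10^(-22)\<close>, so that it locates the minimum much more closely than the
tolerance \<open>5/10^18\<close>.\<close>

lemma critical_cubic_root_bounds:
  assumes "critical_cubic b = 0"
  shows "5919267057184338395180 / 10^22 < b" "b < 5919267057184338395181 / 10^22"
proof -
  have "critical_cubic (5919267057184338395180 / 10^22) < 0"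
    "0 < critical_cubic (5919267057184338395181 / 10^22)"
    by (simp_all add: critical_cubic_def power2_eq_square power3_eq_cube)
  then have "critical_cubic (5919267057184338395180 / 10^22) < critical_cubic b"
    "critical_cubic b < critical_cubic (5919267057184338395181 / 10^22)"
    using assms by simp_all
  then show "5919267057184338395180 / 10^22 < b" "b < 5919267057184338395181 / 10^22"
    unfolding strict_mono_less[OF critical_cubic_strict_mono] .
qed

section \<open>The minimum of the polynomial\<close>

lemma corner_value_111:
  "corner_value 1 1 1 s = (1 + s) * (2 - s)^2 * (8*s^4 - 19*s^3 + 25*s^2 - 16*s + 4) / 64"
  unfolding corner_value_def face_polynomial_def crossing_def straight_def
  by (simp add: field_simps eval_nat_numeral)

lemma corner_value_111_deriv:
  "(corner_value 1 1 1 has_real_derivative (2 - s) * (8 + 6*s - 8*s^2) / 64 * critical_cubic s) (at s)"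
  unfolding corner_value_111[abs_def] critical_cubic_def
  by ((rule derivative_eq_intros refl | simp)+, simp add: field_simps eval_nat_numeral)

text \<open>The second factor in the proof is the quotient in the polynomial division by the cubic.\<close>

lemma corner_value_111_root:
  assumes "critical_cubic b = 0"
  shows "corner_value 1 1 1 b = (13233*b^2 - 10268*b + 2536) / 67228"
proof -
  have "corner_value 1 1 1 b - (13233*b^2 - 10268*b + 2536) / 67228
      = critical_cubic b * (- 14271/268912 + 2021/38416 * b + 785/21952 * b^2 - 197/3136 * b^3 + b^4/56)"
    unfolding corner_value_111 critical_cubic_def by (simp add: field_simps eval_nat_numeral)
  then show ?thesis using assms by simp
qed

lemma corner_value_111_approx:
  assumes "critical_cubic b = 0"
  shows "\<bar>corner_value 1 1 1 b - 1628247758894465 / 10^17\<bar> \<le> 5 / 10^18"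
proof -
  note bounds = critical_cubic_root_bounds[OF assms]
  have "(5919267057184338395180 / 10^22)^2 \<le> b^2" "b^2 \<le> (5919267057184338395181 / 10^22)^2"
    using bounds by (intro power_mono; simp)+
  then show ?thesis
    using bounds unfolding corner_value_111_root[OF assms] by (simp add: abs_le_iff power2_eq_square)
qed

text \<open>The derivative has the sign of the cubic on \<open>[0, 1]\<close>, so the value falls up to the root and rises after
it.\<close>

lemma corner_value_111_min:
  assumes b: "critical_cubic b = 0" and s: "0 \<le> s" "s \<le> 1" "s \<noteq> b"
  shows "corner_value 1 1 1 b < corner_value 1 1 1 s"
proof -
  have b01: "0 < b" "b < 1" using critical_cubic_root_bounds[OF b] by simp_all
  have fac: "0 < (2 - x) * (8 + 6*x - 8*x^2) / 64" if "0 \<le> x" "x \<le> 1" for x :: real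
  proof -
    have "x * x \<le> x * 1" using that by (intro mult_left_mono) auto
    then have "0 < 8 + 6*x - 8*x^2" using that by (simp add: power2_eq_square)
    then show ?thesis using that by simp
  qed
  show ?thesis
  proof (cases "s < b")
    case True
    show ?thesis
    proof (rule DERIV_neg_imp_decreasing_open[OF True])
      fix x assume x: "s < x" "x < b"
      then have "critical_cubic x < 0" using strict_mono_less[OF critical_cubic_strict_mono, of x b] b by simp
      moreover have "0 < (2 - x) * (8 + 6*x - 8*x^2) / 64" using fac x s b01 by simp
      ultimately show "\<exists>y. (corner_value 1 1 1 has_real_derivative y) (at x) \<and> y < 0"
        using corner_value_111_deriv mult_pos_neg by blast
    qed (auto intro!: DERIV_continuous_on corner_value_111_deriv[THEN DERIV_subset])
  next
    case False
    with s have bs: "b < s" by simp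
    show ?thesis
    proof (rule DERIV_pos_imp_increasing_open[OF bs])
      fix x assume x: "b < x" "x < s"
      then have "0 < critical_cubic x" using strict_mono_less[OF critical_cubic_strict_mono, of b x] b by simp
      moreover have "0 < (2 - x) * (8 + 6*x - 8*x^2) / 64" using fac x s b01 by simp
      ultimately show "\<exists>y. (corner_value 1 1 1 has_real_derivative y) (at x) \<and> y > 0"
        using corner_value_111_deriv mult_pos_pos by blast
    qed (auto intro!: DERIV_continuous_on corner_value_111_deriv[THEN DERIV_subset])
  qed
qed

text \<open>Strictness may fail at the endpoint \<open>T\<close>, but then only there. This one-sided form lets the interpolation
be iterated: only the balanced corner can attain the minimum.\<close>

lemma affine_gt:
  fixes g :: "real \<Rightarrow> real"
  assumes affine: "\<And>t. g t = A + B * t"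
    and "0 \<le> t" "t \<le> T" "g 0 > m" "g T \<ge> m" "t = T \<Longrightarrow> g T > m"
  shows "g t > m"
proof (cases "t = T")
  case False
  have "T * (g t - m) = (T - t) * (g 0 - m) + t * (g T - m)"
    by (simp add: affine algebra_simps)
  also have "\<dots> > 0"
    using assms(2-) False by (intro add_pos_nonneg mult_pos_pos mult_nonneg_nonneg) auto
  finally show ?thesis using assms(2,3) False by (simp add: zero_less_mult_iff)
qed (use assms(2-) in auto)

lemma face_polynomial_affine_z: "face_polynomial s w w' z =
   (crossing s w * crossing s w' * s + (1-s) * (straight s w * straight s w' * (1-s)^2))
 + (crossing s w * crossing s w' - (1-s) * (straight s w * straight s w' * (3 - s))) * z"
  by (simp add: face_polynomial_def crossing_def[of "1-s"] straight_def[of "1-s"] algebra_simps)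

lemma face_polynomial_affine_w: "face_polynomial s w w' z =
   (s^2 * crossing s w' * straight (1-s) z + (1-s)^2 * (straight s w' * crossing (1-s) z))
 + ((1-s) * (straight s w' * crossing (1-s) z) - (2+s) * crossing s w' * straight (1-s) z) * w"
  by (simp add: face_polynomial_def crossing_def[of s w] straight_def[of s w] algebra_simps power2_eq_square)

lemma face_polynomial_swap: "face_polynomial s w w' z = face_polynomial s w' w z"
  by (simp add: face_polynomial_def)

text \<open>Starting from the corners, the bound is extended to all \<open>z\<close>, then to all \<open>w'\<close>, then to all \<open>w\<close>. At each
stage it remains strict unless every product treated so far is maximal and \<open>s\<close> is the root.\<close>

lemma face_polynomial_min:
  assumes b: "critical_cubic b = 0"
    and s: "0 \<le> s" "s \<le> 1"
    and w: "0 \<le> w" "w \<le> s^2/4" and w': "0 \<le> w'" "w' \<le> s^2/4" and z: "0 \<le> z" "z \<le> (1 - s)^2/4"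
    and ne: "(s, w, w', z) \<noteq> (b, s^2/4, s^2/4, (1 - s)^2/4)"
  shows "corner_value 1 1 1 b < face_polynomial s w w' z"
proof -
  define m where "m = corner_value 1 1 1 b"
  define W Z where "W = s^2/4" and "Z = (1 - s)^2/4"
  have m: "m < 1/60"
    using abs_le_D1[OF corner_value_111_approx[OF b]] by (simp add: m_def)
  have vert: "face_polynomial s (c * W) (c' * W) (d * Z) > m"
    if "c \<in> {0, 1}" "c' \<in> {0, 1}" "d \<in> {0, 1}" "(c, c', d) \<noteq> (1, 1, 1)" for c c' d
    using corner_value_gt[OF s that] m unfolding corner_value_def W_def Z_def by simp
  have top: "face_polynomial s W W Z \<ge> m" "s \<noteq> b \<Longrightarrow> face_polynomial s W W Z > m"
    using corner_value_111_min[OF b s] unfolding m_def W_def Z_def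
    by (cases "s = b"; simp add: corner_value_def)+
  note z = z[folded Z_def] and w = w[folded W_def] and w' = w'[folded W_def]
  have z_edge: "face_polynomial s (c * W) (c' * W) z > m"
    if "c \<in> {0, 1}" "c' \<in> {0, 1}" "(c, c') \<noteq> (1, 1)" for c c'
    using vert[of c c' 0] vert[of c c' 1] that
    by (intro affine_gt[where g = "face_polynomial s (c * W) (c' * W)" and T = Z, OF face_polynomial_affine_z z]) auto
  have z_top_strict: "face_polynomial s W W z > m" if "z \<noteq> Z \<or> s \<noteq> b"
    using vert[of 1 1 0] top that
    by (intro affine_gt[where g = "face_polynomial s W W" and T = Z, OF face_polynomial_affine_z z]) auto
  have z_top: "face_polynomial s W W z \<ge> m"
    using z_top_strict top by (cases "z = Z \<and> s = b") auto
  have affine_w': "face_polynomial s w t z =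
      (s^2 * crossing s w * straight (1-s) z + (1-s)^2 * (straight s w * crossing (1-s) z))
    + ((1-s) * (straight s w * crossing (1-s) z) - (2+s) * crossing s w * straight (1-s) z) * t" for w t
    by (subst face_polynomial_swap) (rule face_polynomial_affine_w)
  have w'_edge: "face_polynomial s 0 w' z > m"
    using z_edge[of 0 0] z_edge[of 0 1]
    by (intro affine_gt[where g = "\<lambda>t. face_polynomial s 0 t z" and T = W, OF affine_w' w']) auto
  have w'_top_strict: "face_polynomial s W w' z > m" if "w' \<noteq> W \<or> z \<noteq> Z \<or> s \<noteq> b"
    using z_edge[of 1 0] z_top z_top_strict that
    by (intro affine_gt[where g = "\<lambda>t. face_polynomial s W t z" and T = W, OF affine_w' w']) auto
  have w'_top: "face_polynomial s W w' z \<ge> m"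
    using w'_top_strict z_top by (cases "w' = W \<and> z = Z \<and> s = b") auto
  have "face_polynomial s w w' z > m"
    using w'_edge w'_top w'_top_strict ne[folded W_def Z_def]
    by (intro affine_gt[where g = "\<lambda>t. face_polynomial s t w' z" and T = W, OF face_polynomial_affine_w w]) auto
  then show ?thesis by (simp add: m_def)
qed

section \<open>From the polynomial back to the matrices\<close>

text \<open>The row and column sums are solved for the entries outside the six chosen ones. Row 3 and column 6
have the entry at \<open>(3, 6)\<close> in common; comparing their sums yields \<open>u + v = p + q\<close>.\<close>

lemma ds_face_Z8_entries:
  assumes "B \<in> ds_face 8 Z8"
  defines "p \<equiv> B $$ (0, 0)" and "q \<equiv> B $$ (0, 1)" and "r \<equiv> B $$ (0, 2)" and "t \<equiv> B $$ (0, 3)"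
    and "u \<equiv> B $$ (3, 4)" and "v \<equiv> B $$ (3, 5)"
  shows "r + t = 1 - (p + q)" "u + v = p + q"
    and "\<And>i j. i < 8 \<Longrightarrow> j < 8 \<Longrightarrow> B $$ (i, j) = sparse_entry (face_rows p q r t u v ! i) j"
proof -
  have zero: "B $$ (i, j) = 0" if "i < 8" "j < 8" "(i, j) \<notin> supp_mat D8" for i j
    using assms(1) that by (auto simp: ds_face_def Z8_def positions_def)
  have rows: "\<forall>i<8. (\<Sum>j<8. B $$ (i, j)) = 1" and cols: "\<forall>j<8. (\<Sum>i<8. B $$ (i, j)) = 1"
    using assms(1) by (auto simp: ds_face_def doubly_stochastic_mats_def)
  have r: "p + q + r + t = 1" "B $$ (1, 0) + B $$ (1, 6) = 1" "B $$ (2, 1) + B $$ (2, 6) = 1"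
      "u + v + B $$ (3, 6) = 1" "B $$ (4, 2) + B $$ (4, 7) = 1" "B $$ (5, 3) + B $$ (5, 7) = 1"
      "B $$ (6, 4) + B $$ (6, 7) = 1" "B $$ (7, 5) + B $$ (7, 7) = 1"
    using rows unfolding all_less_8 lessThan_8
    by (simp_all add: zero supp_D8 p_def q_def r_def t_def u_def v_def)
  have c: "p + B $$ (1, 0) = 1" "q + B $$ (2, 1) = 1" "r + B $$ (4, 2) = 1" "t + B $$ (5, 3) = 1"
      "u + B $$ (6, 4) = 1" "v + B $$ (7, 5) = 1" "B $$ (1, 6) + B $$ (2, 6) + B $$ (3, 6) = 1"
    using cols unfolding all_less_8 lessThan_8
    by (simp_all add: zero supp_D8 p_def q_def r_def t_def u_def v_def)
  show "r + t = 1 - (p + q)" "u + v = p + q"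
    using r c by simp_all
  have forced: "B $$ (1, 0) = 1 - p" "B $$ (1, 6) = p" "B $$ (2, 1) = 1 - q" "B $$ (2, 6) = q"
      "B $$ (3, 6) = r + t" "B $$ (4, 2) = 1 - r" "B $$ (4, 7) = r" "B $$ (5, 3) = 1 - t" "B $$ (5, 7) = t"
      "B $$ (6, 4) = 1 - u" "B $$ (6, 7) = u" "B $$ (7, 5) = 1 - v" "B $$ (7, 7) = v"
    using r c by linarith+
  have free: "B $$ (0, 0) = p" "B $$ (0, 1) = q" "B $$ (0, 2) = r" "B $$ (0, 3) = t"
      "B $$ (3, 4) = u" "B $$ (3, 5) = v"
    by (simp_all add: p_def q_def r_def t_def u_def v_def)
  have "\<forall>i<8. \<forall>j<8. B $$ (i, j) = sparse_entry (face_rows p q r t u v ! i) j"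
    unfolding all_less_8 face_rows_def 
    by (simp add: zero supp_D8 free[unfolded One_nat_def] forced[unfolded One_nat_def])
  then show "\<And>i j. i < 8 \<Longrightarrow> j < 8 \<Longrightarrow> B $$ (i, j) = sparse_entry (face_rows p q r t u v ! i) j"
    by blast
qed

lemma A_mat_carrier: "A_mat b \<in> carrier_mat 8 8"
  by (intro carrier_matI) (simp_all add: A_mat_def mat_of_rows_list_def)

lemma A_mat_entries:
  assumes "i < 8" "j < 8"
  shows "A_mat b $$ (i, j) =
    sparse_entry (face_rows (b/2) (b/2) ((1-b)/2) ((1-b)/2) (b/2) (b/2) ! i) j"
proof -
  have "\<forall>i<8. \<forall>j<8. A_mat b $$ (i, j) =
      sparse_entry (face_rows (b/2) (b/2) ((1-b)/2) ((1-b)/2) (b/2) (b/2) ! i) j"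
    by (simp add: all_less_8 A_mat_def mat_of_rows_list_def face_rows_def field_simps)
  with assms show ?thesis by blast
qed

lemma supp_A_mat:
  assumes "0 < b" "b < 1"
  shows "supp_mat (A_mat b) = supp_mat D8"
proof (rule supp_mat_eqI[OF A_mat_carrier])
  show "supp_mat D8 \<subseteq> {..<8} \<times> {..<8}"
    using supp_D8_positions by (simp add: positions_def)
  show "\<forall>i<8. \<forall>j<8. A_mat b $$ (i, j) \<noteq> 0 \<longleftrightarrow> (i, j) \<in> supp_mat D8"
    using assms by (simp add: all_less_8 A_mat_def mat_of_rows_list_def supp_D8)
qed

lemma A_mat_nonneg:
  assumes "0 \<le> b" "b \<le> 1" "i < 8" "j < 8"
  shows "0 \<le> A_mat b $$ (i, j)"
proof -
  have "\<forall>i<8. \<forall>j<8. 0 \<le> A_mat b $$ (i, j)"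
    using assms by (simp add: all_less_8 A_mat_def mat_of_rows_list_def)
  with assms show ?thesis by blast
qed

lemma A_mat_in_face:
  assumes "0 < b" "b < 1"
  shows "A_mat b \<in> ds_face 8 Z8"
proof -
  have "\<forall>i<8. (\<Sum>j<8. A_mat b $$ (i, j)) = 1" "\<forall>j<8. (\<Sum>i<8. A_mat b $$ (i, j)) = 1"
    unfolding all_less_8 lessThan_8
    by (simp_all add: A_mat_def mat_of_rows_list_def field_simps)
  moreover have "A_mat b $$ (i, j) = 0" if "(i, j) \<in> Z8" for i j
    using that A_mat_carrier[of b] unfolding Z8_def positions_def supp_A_mat[OF assms, symmetric]
    by (auto simp: supp_mat_def)
  ultimately show ?thesis
    using A_mat_carrier A_mat_nonneg assms
    by (auto simp: ds_face_def doubly_stochastic_mats_def)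
qed

lemma permanent_on_face:
  assumes B: "B \<in> ds_face 8 Z8"
  shows "permanent B = face_polynomial (B $$ (0,0) + B $$ (0,1)) (B $$ (0,0) * B $$ (0,1))
    (B $$ (3,4) * B $$ (3,5)) (B $$ (0,2) * B $$ (0,3))"
proof -
  note e = ds_face_Z8_entries[OF B]
  have "permanent B = sparse_permanent (face_rows (B $$ (0,0)) (B $$ (0,1)) (B $$ (0,2)) (B $$ (0,3))
      (B $$ (3,4)) (B $$ (3,5))) {..<8}"
  proof (rule permanent_sparse[OF _ _ e(3)])
    show "B \<in> carrier_mat 8 8" using B by (simp add: ds_face_def doubly_stochastic_mats_def)
  qed (simp_all add: face_rows_def)
  then show ?thesis
    unfolding sparse_permanent_face_rows crossing_eq straight_eq
    by (simp add: e(1,2) face_polynomial_def)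
qed

lemma permanent_A_mat:
  assumes "0 < b" "b < 1"
  shows "permanent (A_mat b) = corner_value 1 1 1 b"
proof -
  have "permanent (A_mat b) = face_polynomial b (b^2/4) (b^2/4) ((1-b)^2/4)"
    unfolding permanent_on_face[OF A_mat_in_face[OF assms]]
    by (simp add: A_mat_def mat_of_rows_list_def power2_eq_square)
  then show ?thesis by (simp add: corner_value_def)
qed

text \<open>The range of the product of a pair with given sum; the upper end is attained only by equal entries.\<close>

lemma mult_le_quarter_square: "p * q \<le> (p + q)^2 / 4" for p q :: real
  using zero_le_power2[of "p - q"] by (simp add: power2_eq_square algebra_simps)

lemma mult_eq_quarter_square: "p * q = (p + q)^2 / 4 \<Longrightarrow> p = (p + q) / 2 \<and> q = (p + q) / 2" for p q :: real
proof -
  assume "p * q = (p + q)^2 / 4"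
  then have "(p - q)^2 = 0" by (simp add: power2_eq_square algebra_simps)
  then show ?thesis by simp
qed

lemma A_mat_unique_minimizer:
  assumes b: "critical_cubic b = 0" and B: "B \<in> ds_face 8 Z8" and ne: "B \<noteq> A_mat b"
  shows "permanent (A_mat b) < permanent B"
proof -
  have b01: "0 < b" "b < 1" using critical_cubic_root_bounds[OF b] by simp_all
  define p q r t u v where "p = B $$ (0,0)" and "q = B $$ (0,1)" and "r = B $$ (0,2)"
    and "t = B $$ (0,3)" and "u = B $$ (3,4)" and "v = B $$ (3,5)"
  note defs = this
  note e = ds_face_Z8_entries[OF B, folded defs]
  have carrier: "B \<in> carrier_mat 8 8"
    using B by (simp add: ds_face_def doubly_stochastic_mats_def)
  have nonneg: "0 \<le> p" "0 \<le> q" "0 \<le> r" "0 \<le> t" "0 \<le> u" "0 \<le> v"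
    using B by (auto simp: ds_face_def doubly_stochastic_mats_def defs)
  have "corner_value 1 1 1 b < face_polynomial (p + q) (p * q) (u * v) (r * t)"
  proof (rule face_polynomial_min[OF b])
    show "0 \<le> p + q" "p + q \<le> 1" "0 \<le> p * q" "0 \<le> u * v" "0 \<le> r * t"
      using nonneg e(1) by simp_all
    show "p * q \<le> (p + q)^2 / 4" "u * v \<le> (p + q)^2 / 4" "r * t \<le> (1 - (p + q))^2 / 4"
      using mult_le_quarter_square[of p q] mult_le_quarter_square[of u v] mult_le_quarter_square[of r t]
      unfolding e(1,2) by simp_all
    show "(p + q, p * q, u * v, r * t) \<noteq> (b, (p + q)^2/4, (p + q)^2/4, (1 - (p + q))^2/4)"
    proof
      assume "(p + q, p * q, u * v, r * t) = (b, (p + q)^2/4, (p + q)^2/4, (1 - (p + q))^2/4)"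
      then have eqs: "p + q = b" "p * q = (p + q)^2/4" "u * v = (u + v)^2/4" "r * t = (r + t)^2/4"
        unfolding e(1,2) prod.inject by blast+
      have "p = b/2" "q = b/2" "u = b/2" "v = b/2" "r = (1-b)/2" "t = (1-b)/2"
        using mult_eq_quarter_square[OF eqs(2)] mult_eq_quarter_square[OF eqs(3)]
          mult_eq_quarter_square[OF eqs(4)]
        unfolding e(1,2) eqs(1) by blast+
      note coordinates = this
      have "B $$ (i, j) = A_mat b $$ (i, j)" if "i < 8" "j < 8" for i j
        by (simp only: e(3)[OF that] A_mat_entries[OF that] coordinates)
      then have "B = A_mat b"
        using carrier A_mat_carrier[of b] by (intro eq_matI) auto
      with ne show False ..
    qed
  qed
  then show ?thesis
    unfolding permanent_A_mat[OF b01] permanent_on_face[OF B] defs .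
qed

lemma all_less_7: "(\<forall>i<7. P i) \<longleftrightarrow> P 0 \<and> P 1 \<and> P 2 \<and> P 3 \<and> P 4 \<and> P 5 \<and> P (6::nat)"
proof -
  have "{..<7} = {0, 1, 2, 3, 4, 5, 6::nat}" by auto
  moreover have "(\<forall>i<7. P i) \<longleftrightarrow> (\<forall>i\<in>{..<7}. P i)" by blast
  ultimately show ?thesis by simp
qed

text \<open>Without column 4, row 6 must use column 7. This leaves a single choice for each of the other rows, so
the minor is a monomial in the entries.\<close>

lemma permanent_A_mat_minor:
  "permanent (mat_delete (A_mat b) 0 4)
    = (1 - b/2)^3 * ((1 + b)/2)^2 * (1 - b) * (b/2)"
proof -
  \<comment> \<open>Rows move up by one, and the columns after column 4 move left by one.\<close>
  define rs :: "(nat \<times> real) list list" where "rs = [[(0, 1 - b/2), (5, b/2)], [(1, 1 - b/2), (5, b/2)], [(4, b/2), (5, 1 - b)],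
    [(2, (1 + b)/2), (6, (1 - b)/2)], [(3, (1 + b)/2), (6, (1 - b)/2)], [(6, b/2)],
    [(4, 1 - b/2), (6, b/2)]]"
  have "\<forall>i<7. \<forall>j<7. mat_delete (A_mat b) 0 4 $$ (i, j) = sparse_entry (rs ! i) j"
    by (simp add: all_less_7 mat_delete_def A_mat_def mat_of_rows_list_def rs_def)
  then have entries: "mat_delete (A_mat b) 0 4 $$ (i, j) = sparse_entry (rs ! i) j" if "i < 7" "j < 7" for i j
    using that by blast
  have "mat_delete (A_mat b) 0 4 \<in> carrier_mat 7 7"
    using A_mat_carrier[of b] by (intro carrier_matI) simp_all
  then have "permanent (mat_delete (A_mat b) 0 4) = sparse_permanent rs {..<7}"
    by (rule permanent_sparse[OF _ _ entries]) (simp add: rs_def)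
  also have "{..<7} = {0, 1, 2, 3, 4, 5, 6::nat}" by auto
  also have "sparse_permanent rs {0, 1, 2, 3, 4, 5, 6} = (1 - b/2)^3 * ((1 + b)/2)^2 * (1 - b) * (b/2)"
    unfolding rs_def by (simp add: insert_Diff_if power2_eq_square power3_eq_cube)
  finally show ?thesis .
qed

text \<open>As for the permanent, the second factor in the proof is the quotient in the division by the cubic.\<close>

lemma permanent_gap:
  assumes b: "critical_cubic b = 0"
  shows "permanent (mat_delete (A_mat b) 0 4) - permanent (A_mat b) = (286 + 1599*b - 3232*b^2) / 9604"
proof -
  have b01: "0 < b" "b < 1" using critical_cubic_root_bounds[OF b] by simp_all
  have "permanent (mat_delete (A_mat b) 0 4) - permanent (A_mat b) - (286 + 1599*b - 3232*b^2) / 9604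
     = critical_cubic b * (2687/38416 - 327/10976 * b - 65/1568 * b^2 + 25/448 * b^3 - b^4/64)"
    unfolding permanent_A_mat[OF b01] permanent_A_mat_minor corner_value_111 critical_cubic_def
    by (simp add: field_simps eval_nat_numeral)
  then show ?thesis using b by simp
qed

text \<open>The quadratic falls on the interval in question, and the lower bound is its value at \<open>3/5\<close>.\<close>

lemma gap_lower:
  assumes "59/100 < b" "b < 3/5"
  shows "2047/240100 < (286 + 1599*b - 3232*b^2) / (9604::real)"
proof -
  have "0 < (3/5 - b) * (3232 * (b + 3/5) - 1599)" using assms by (intro mult_pos_pos) auto
  then show ?thesis by (simp add: power2_eq_square field_simps)
qed

lemma nearly_decomposable_A_mat:
  assumes "0 < b" "b < 1"
  shows "nearly_decomposable (A_mat b)"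
proof -
  have "\<forall>i<8. \<forall>j<8. 0 \<le> D8 $$ (i, j)"
    by (simp add: all_less_8 D8_def mat_of_rows_list_def)
  then show ?thesis
    using nearly_decomposable_cong_supp[OF A_mat_carrier D8_carrier _ _ supp_A_mat[OF assms]]
      A_mat_nonneg[of b] assms nearly_decomposable_D8 by auto
qed

section \<open>The counterexample\<close>

theorem theorem1:
  shows "(\<exists>!\<beta>::real. 59/100 < \<beta> \<and> \<beta> < 3/5 \<and> 7*\<beta>^3 - 13*\<beta>^2 + 12*\<beta> - 4 = 0) \<and>
    (\<forall>\<beta>::real. 59/100 < \<beta> \<and> \<beta> < 3/5 \<and> 7*\<beta>^3 - 13*\<beta>^2 + 12*\<beta> - 4 = 0 \<longrightarrow>
      (nearly_decomposable D8 \<and>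
       supp_mat (A_mat \<beta>) = supp_mat D8 \<and>
       A_mat \<beta> \<in> ds_face 8 Z8 \<and>
       (\<forall>B \<in> ds_face 8 Z8. B \<noteq> A_mat \<beta> \<longrightarrow> permanent (A_mat \<beta>) < permanent B)) \<and>
      (permanent (A_mat \<beta>) = (13233*\<beta>^2 - 10268*\<beta> + 2536) / 67228 \<and>
       \<bar>permanent (A_mat \<beta>) - 1628247758894465 / 10^17\<bar> \<le> 5 / 10^18) \<and>
      ((0, 4) \<in> Z8 \<and>
       permanent (mat_delete (A_mat \<beta>) 0 4) - permanent (A_mat \<beta>)
         = (286 + 1599*\<beta> - 3232*\<beta>^2) / 9604 \<and>
       (286 + 1599*\<beta> - 3232*\<beta>^2) / 9604 > 2047/240100 \<and>
       (2047/240100 :: real) > 0) \<and>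
      (\<not> tie_point (A_mat \<beta>) (0, 4) \<and> \<not> tie_point_supp 8 (supp_mat D8) (0, 4))) \<and>
    \<not> (\<forall>n Z A i j.
         Z \<subseteq> positions n \<and>
         nearly_decomposable A \<and>
         A \<in> ds_face n Z \<and>
         (\<forall>B \<in> ds_face n Z. permanent A \<le> permanent B) \<and>
         (i, j) \<in> Z \<and>
         permanent (mat_delete A i j) > permanent A
         \<longrightarrow> tie_point A (i, j))"
  unfolding critical_cubic_def[symmetric]
proof (intro conjI)
  obtain b where b: "59/100 < b" "b < 3/5" "critical_cubic b = 0" using critical_cubic_root_exists by blast
  have b01: "0 < b" "b < 1" using b by simp_all
  have g: "(0, 4) \<in> Z8" by (simp add: Z8_def positions_def supp_D8)
  have not_tie: "\<not> tie_point (A_mat \<beta>) (0, 4)" if "0 < \<beta>" "\<beta> < 1" for \<beta>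
    using not_tie_point_D8 A_mat_carrier[of \<beta>] by (simp add: tie_point_def supp_A_mat[OF that])
  show "\<exists>!\<beta>. 59/100 < \<beta> \<and> \<beta> < 3/5 \<and> critical_cubic \<beta> = 0"
  proof (rule ex1I[of _ b])
    show "59/100 < b \<and> b < 3/5 \<and> critical_cubic b = 0" using b by blast
    show "\<beta> = b" if "59/100 < \<beta> \<and> \<beta> < 3/5 \<and> critical_cubic \<beta> = 0" for \<beta>
      using that b(3) strict_mono_eq[OF critical_cubic_strict_mono, of \<beta> b] by simp
  qed
  show "\<forall>\<beta>. 59/100 < \<beta> \<and> \<beta> < 3/5 \<and> critical_cubic \<beta> = 0 \<longrightarrow>
      (nearly_decomposable D8 \<and>
       supp_mat (A_mat \<beta>) = supp_mat D8 \<and>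
       A_mat \<beta> \<in> ds_face 8 Z8 \<and>
       (\<forall>B \<in> ds_face 8 Z8. B \<noteq> A_mat \<beta> \<longrightarrow> permanent (A_mat \<beta>) < permanent B)) \<and>
      (permanent (A_mat \<beta>) = (13233*\<beta>^2 - 10268*\<beta> + 2536) / 67228 \<and>
       \<bar>permanent (A_mat \<beta>) - 1628247758894465 / 10^17\<bar> \<le> 5 / 10^18) \<and>
      ((0, 4) \<in> Z8 \<and>
       permanent (mat_delete (A_mat \<beta>) 0 4) - permanent (A_mat \<beta>)
         = (286 + 1599*\<beta> - 3232*\<beta>^2) / 9604 \<and>
       (286 + 1599*\<beta> - 3232*\<beta>^2) / 9604 > 2047/240100 \<and>
       (2047/240100 :: real) > 0) \<and>
      (\<not> tie_point (A_mat \<beta>) (0, 4) \<and> \<not> tie_point_supp 8 (supp_mat D8) (0, 4))"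
    (is "\<forall>\<beta>. _ \<longrightarrow> ?goal \<beta>")
  proof (intro allI impI, elim conjE)
    fix \<beta> :: real assume \<beta>: "59/100 < \<beta>" "\<beta> < 3/5" "critical_cubic \<beta> = 0"
    then have \<beta>01: "0 < \<beta>" "\<beta> < 1" by simp_all
    note facts = nearly_decomposable_D8 supp_A_mat[OF \<beta>01] A_mat_in_face[OF \<beta>01]
      corner_value_111_root[OF \<beta>(3), folded permanent_A_mat[OF \<beta>01]]
      corner_value_111_approx[OF \<beta>(3), folded permanent_A_mat[OF \<beta>01]]
      g permanent_gap[OF \<beta>(3)] gap_lower[OF \<beta>(1,2)] not_tie[OF \<beta>01] not_tie_point_D8
    have minimizer: "\<forall>B \<in> ds_face 8 Z8. B \<noteq> A_mat \<beta> \<longrightarrow> permanent (A_mat \<beta>) < permanent B"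
      using A_mat_unique_minimizer[OF \<beta>(3)] by blast
    show "?goal \<beta>"
      by (intro conjI; (fact facts minimizer | simp))
  qed
  show "\<not> (\<forall>n Z A i j.
         Z \<subseteq> positions n \<and>
         nearly_decomposable A \<and>
         A \<in> ds_face n Z \<and>
         (\<forall>B \<in> ds_face n Z. permanent A \<le> permanent B) \<and>
         (i, j) \<in> Z \<and>
         permanent (mat_delete A i j) > permanent A
         \<longrightarrow> tie_point A (i, j))"
  proof
    assume conj: "\<forall>n Z A i j.
         Z \<subseteq> positions n \<and>
         nearly_decomposable A \<and>
         A \<in> ds_face n Z \<and>
         (\<forall>B \<in> ds_face n Z. permanent A \<le> permanent B) \<and>
         (i, j) \<in> Z \<and>
         permanent (mat_delete A i j) > permanent A
         \<longrightarrow> tie_point A (i, j)"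
    have "permanent (A_mat b) \<le> permanent B" if "B \<in> ds_face 8 Z8" for B
      using A_mat_unique_minimizer[OF b(3) that] by (cases "B = A_mat b") auto
    moreover have "permanent (mat_delete (A_mat b) 0 4) > permanent (A_mat b)"
      using permanent_gap[OF b(3)] gap_lower[OF b(1,2)] by simp
    moreover have "Z8 \<subseteq> positions 8" by (auto simp: Z8_def)
    ultimately have "tie_point (A_mat b) (0, 4)"
      using conj nearly_decomposable_A_mat[OF b01] A_mat_in_face[OF b01] g by blast
    with not_tie b01 show False by blast
  qed
qed

end
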